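(* Let $r,\tilde r\geq 1$. Let $\mathcal{G}$ be a CPR graph on a finite vertex set $\Omega_1$ with labels $0,1,\dots,r-1$, and suppose that $\mathcal{G}$ has a vertex $A$ which is incident with exactly one edge, this edge has label $0$, and every other edge of $\mathcal{G}$ has label at least $1$. Let $\tilde{\mathcal{G}}$ be a CPR graph on a finite vertex set $\Omega_2$ (disjoint from $\Omega_1$) with labels $0,1,\dots,\tilde r-1$, and suppose that $\tilde{\mathcal{G}}$ has a vertex $B$ which is incident with exactly one edge, this edge has label $0$, and every other edge of $\tilde{\mathcal{G}}$ has label at least $1$. Let $\mathcal{H}$ be the edge-labelled multigraph obtained from the disjoint union of $\mathcal{G}$ and $\tilde{\mathcal{G}}$ by identifying $A$ and $B$ into a single vertex $C$, and by replacing the label $l$ of every edge coming from $\mathcal{G}$ by the label $-(l+1)$ (edges coming from $\tilde{\mathcal{G}}$ keep their labels). Then $\mathcal{H}$, with labels $-r,-r+1,\dots,-1,0,1,\dots,\tilde r-1$ ordered increasingly, is a CPR graph.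
   Context: A string group generated by involutions (sggi) of rank $r$ is a group $G$ together with an ordered sequence $(\rho_0,\dots,\rho_{r-1})$ of involutions generating $G$ such that $(\rho_i\rho_j)^2=1$ whenever $|i-j|\geq 2$. It is a string C-group if moreover it satisfies the intersection property: $\langle \rho_i : i\in I\rangle\cap\langle\rho_j : j\in J\rangle=\langle \rho_k : k\in I\cap J\rangle$ for all $I,J\subseteq\{0,\dots,r-1\}$. Let $\Omega$ be a finite set and $L$ a set of consecutive integers (ordered increasingly). An edge-labelled multigraph on vertex set $\Omega$ with labels in $L$, in which every vertex is incident with at most one edge of each label and every label of $L$ occurs, determines for each $l\in L$ the involution $\rho_l\in\mathrm{Sym}(\Omega)$ equal to the product of the transpositions $(a\,b)$ over all edges $\{a,b\}$ of label $l$. The graph is then the permutation representation graph of the group $\langle\rho_l : l\in L\rangle$ with generating sequence $(\rho_l)_{l\in L}$ in increasing order of labels, and it is called a CPR graph if this group with this generating sequence is a string C-group. *)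

theory Defs
  imports "HOL-Algebra.Algebra" "HOL-Combinatorics.Transposition"
begin

section \<open>String C-groups\<close>

text \<open>The generating sequence is a list \<open>\<rho>s\<close>; the rank is its length.\<close>

definition sggi :: "('g, 'm) monoid_scheme \<Rightarrow> 'g list \<Rightarrow> bool" where
  "sggi G \<rho>s \<longleftrightarrow>
     group G \<and>
     (\<forall>\<rho>\<in>set \<rho>s. \<rho> \<in> carrier G \<and> \<rho> \<noteq> \<one>\<^bsub>G\<^esub> \<and> \<rho> \<otimes>\<^bsub>G\<^esub> \<rho> = \<one>\<^bsub>G\<^esub>) \<and>
     generate G (set \<rho>s) = carrier G \<and>
     (\<forall>i<length \<rho>s. \<forall>j<length \<rho>s. \<bar>int i - int j\<bar> \<ge> 2 \<longrightarrow>
        (\<rho>s ! i \<otimes>\<^bsub>G\<^esub> \<rho>s ! j) [^]\<^bsub>G\<^esub> (2::nat) = \<one>\<^bsub>G\<^esub>)"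

definition string_C_group :: "('g, 'm) monoid_scheme \<Rightarrow> 'g list \<Rightarrow> bool" where
  "string_C_group G \<rho>s \<longleftrightarrow>
     sggi G \<rho>s \<and>
     (\<forall>I J. I \<subseteq> {..<length \<rho>s} \<and> J \<subseteq> {..<length \<rho>s} \<longrightarrow>
        generate G ((!) \<rho>s ` I) \<inter> generate G ((!) \<rho>s ` J) = generate G ((!) \<rho>s ` (I \<inter> J)))"


section \<open>Permutation representation graphs\<close>

text \<open>An edge is stored as a pair (label, set of its two endpoints). Parallel edges with
  different labels are therefore allowed; parallel edges with equal labels are excluded
  anyway, since a vertex is incident with at most one edge of each label.\<close>

record 'v edge_labelled_graph =
  verts :: "'v set"
  edges :: "(int \<times> 'v set) set"

definition labelled_multigraph :: "int set \<Rightarrow> 'v edge_labelled_graph \<Rightarrow> bool" where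
  "labelled_multigraph L \<Gamma> \<longleftrightarrow>
     finite (verts \<Gamma>) \<and>
     (\<exists>m n. L = {m..n}) \<and>
     edges \<Gamma> \<subseteq> L \<times> {e. e \<subseteq> verts \<Gamma> \<and> card e = 2} \<and>
     (\<forall>v\<in>verts \<Gamma>. \<forall>l\<in>L. \<forall>e e'.
        (l, e) \<in> edges \<Gamma> \<and> (l, e') \<in> edges \<Gamma> \<and> v \<in> e \<and> v \<in> e' \<longrightarrow> e = e') \<and>
     (\<forall>l\<in>L. \<exists>e. (l, e) \<in> edges \<Gamma>)"

text \<open>The analogue of \<^const>\<open>sym_group\<close> for an arbitrary set: permutations are functions on the
  whole type that fix everything outside \<open>\<Omega>\<close>.\<close>

definition Sym :: "'v set \<Rightarrow> ('v \<Rightarrow> 'v) monoid" where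
  "Sym \<Omega> = \<lparr> carrier = {p. p permutes \<Omega>}, monoid.mult = (\<circ>), one = id \<rparr>"

lemma "sym_group n = Sym {1..n}"
  by (simp add: sym_group_def Sym_def)

definition edge_transposition :: "'v set \<Rightarrow> 'v \<Rightarrow> 'v" where
  "edge_transposition e = (THE t. \<exists>a b. e = {a, b} \<and> t = transpose a b)"

lemma edge_transposition_eq: "edge_transposition {a, b} = transpose a b"
  unfolding edge_transposition_def
  by (rule the_equality) (auto simp: doubleton_eq_iff transpose_commute)

text \<open>The edges of one label are pairwise disjoint, so the factors commute and the \<open>fold\<close> does not
  depend on the order of multiplication; see \<open>label_involution_edge\<close> and
  \<open>label_involution_fixed\<close> below.\<close>

definition label_involution :: "'v edge_labelled_graph \<Rightarrow> int \<Rightarrow> 'v \<Rightarrow> 'v" where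
  "label_involution \<Gamma> l =
     Finite_Set.fold (\<lambda>e p. edge_transposition e \<circ> p) id {e. (l, e) \<in> edges \<Gamma>}"

definition label_sequence :: "int set \<Rightarrow> 'v edge_labelled_graph \<Rightarrow> ('v \<Rightarrow> 'v) list" where
  "label_sequence L \<Gamma> = map (label_involution \<Gamma>) (sorted_list_of_set L)"

definition CPR_graph :: "int set \<Rightarrow> 'v edge_labelled_graph \<Rightarrow> bool" where
  "CPR_graph L \<Gamma> \<longleftrightarrow>
     labelled_multigraph L \<Gamma> \<and>
     string_C_group (subgroup_generated (Sym (verts \<Gamma>)) (label_involution \<Gamma> ` L))
       (label_sequence L \<Gamma>)"


section \<open>Gluing two graphs at a vertex\<close>

text \<open>\<open>A\<close> is incident with exactly one edge; it has label 0, and all other edges of the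
  graph have label at least 1.\<close>

definition pendant_zero_vertex :: "'v edge_labelled_graph \<Rightarrow> 'v \<Rightarrow> bool" where
  "pendant_zero_vertex \<Gamma> A \<longleftrightarrow>
     A \<in> verts \<Gamma> \<and>
     (\<exists>e. {(l, e'). (l, e') \<in> edges \<Gamma> \<and> A \<in> e'} = {(0, e)} \<and>
          (\<forall>(l, e')\<in>edges \<Gamma> - {(0, e)}. l \<ge> 1))"

definition identify :: "'v \<Rightarrow> 'v \<Rightarrow> 'v \<Rightarrow> 'v \<Rightarrow> 'v" where
  "identify A B C v = (if v = A \<or> v = B then C else v)"

definition glue ::
    "'v edge_labelled_graph \<Rightarrow> 'v \<Rightarrow> 'v edge_labelled_graph \<Rightarrow> 'v \<Rightarrow> 'v \<Rightarrow> 'v edge_labelled_graph"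
  where
  "glue \<Gamma> A \<Gamma>' B C =
     \<lparr> verts = identify A B C ` (verts \<Gamma> \<union> verts \<Gamma>'),
       edges = {(- (l + 1), identify A B C ` e) | l e. (l, e) \<in> edges \<Gamma>} \<union>
               {(l, identify A B C ` e) | l e. (l, e) \<in> edges \<Gamma>'} \<rparr>"


section \<open>The product of transpositions is well defined\<close>

lemma fold_edge_transposition:
  assumes "finite F" and "\<And>e. e \<in> F \<Longrightarrow> card e = 2" and "disjoint F"
  defines "p \<equiv> Finite_Set.fold (\<lambda>e p. edge_transposition e \<circ> p) id F"
  shows "(\<forall>a b. {a, b} \<in> F \<longrightarrow> p a = b) \<and> (\<forall>a. a \<notin> \<Union>F \<longrightarrow> p a = a)"
proof -
  interpret comp_fun_commute_on F "\<lambda>e p. edge_transposition e \<circ> p"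
  proof
    fix e e' assume *: "e \<in> F" "e' \<in> F"
    then obtain a b c d where "e = {a, b}" "e' = {c, d}"
      using assms(2) by (meson card_2_iff)
    moreover have "e = e' \<or> e \<inter> e' = {}"
      using * assms(3) by (auto simp: disjoint_def)
    ultimately show "(\<circ>) (edge_transposition e') \<circ> (\<circ>) (edge_transposition e) =
        (\<circ>) (edge_transposition e) \<circ> (\<circ>) (edge_transposition e')"
      by (auto simp: fun_eq_iff edge_transposition_eq transpose_def)
  qed
  have "G \<subseteq> F \<Longrightarrow>
      (\<forall>a b. {a, b} \<in> G \<longrightarrow> Finite_Set.fold (\<lambda>e p. edge_transposition e \<circ> p) id G a = b) \<and>
      (\<forall>a. a \<notin> \<Union>G \<longrightarrow> Finite_Set.fold (\<lambda>e p. edge_transposition e \<circ> p) id G a = a)"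
    if "finite G" for G
    using that
  proof (induction G)
    case empty
    then show ?case by simp
  next
    case (insert e G)
    then obtain x y where e: "e = {x, y}" "x \<noteq> y"
      using assms(2) by (metis card_2_iff insert_subset)
    have dj: "e \<inter> f = {}" if "f \<in> G" for f
      using that insert assms(3) unfolding disjoint_def by (metis insert_subset subsetD)
    let ?p = "Finite_Set.fold (\<lambda>e p. edge_transposition e \<circ> p) id G"
    have eq: "Finite_Set.fold (\<lambda>e p. edge_transposition e \<circ> p) id (insert e G)
        = transpose x y \<circ> ?p"
      using fold_insert[OF insert.prems insert.hyps] e by (simp add: edge_transposition_eq)
    have IH: "\<And>a b. {a, b} \<in> G \<Longrightarrow> ?p a = b" "\<And>a. a \<notin> \<Union>G \<Longrightarrow> ?p a = a"
      using insert.IH insert.prems by blast+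
    have xy: "?p x = x" "?p y = y"
      using dj e by (blast intro: IH(2))+
    show ?case
    proof (intro conjI allI impI)
      fix a b assume "{a, b} \<in> insert e G"
      then consider "{a, b} = {x, y}" | "{a, b} \<in> G"
        using e by auto
      then show "Finite_Set.fold (\<lambda>e p. edge_transposition e \<circ> p) id (insert e G) a = b"
      proof cases
        case 1
        then show ?thesis using xy eq by (auto simp: doubleton_eq_iff)
      next
        case 2
        then have "b \<noteq> x" "b \<noteq> y" using dj e by blast+
        then show ?thesis using IH(1)[OF 2] eq by simp
      qed
    next
      fix a assume "a \<notin> \<Union>(insert e G)"
      then show "Finite_Set.fold (\<lambda>e p. edge_transposition e \<circ> p) id (insert e G) a = a"
        using IH(2)[of a] eq e by simp
    qed
  qed
  then show ?thesis using assms(1) unfolding p_def by blast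
qed

lemma label_class:
  assumes "labelled_multigraph L \<Gamma>"
  shows "finite {e. (l, e) \<in> edges \<Gamma>}" "\<And>e. e \<in> {e. (l, e) \<in> edges \<Gamma>} \<Longrightarrow> card e = 2"
    "disjoint {e. (l, e) \<in> edges \<Gamma>}"
proof -
  have "{e. (l, e) \<in> edges \<Gamma>} \<subseteq> Pow (verts \<Gamma>)"
    using assms unfolding labelled_multigraph_def by blast
  then show "finite {e. (l, e) \<in> edges \<Gamma>}"
    using assms unfolding labelled_multigraph_def by (meson finite_Pow_iff finite_subset)
  show "\<And>e. e \<in> {e. (l, e) \<in> edges \<Gamma>} \<Longrightarrow> card e = 2"
    using assms unfolding labelled_multigraph_def by blast
  show "disjoint {e. (l, e) \<in> edges \<Gamma>}"
    using assms unfolding labelled_multigraph_def disjoint_def by blast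
qed

lemma label_involution_edge:
  assumes "labelled_multigraph L \<Gamma>" "(l, {a, b}) \<in> edges \<Gamma>"
  shows "label_involution \<Gamma> l a = b"
  using fold_edge_transposition[OF label_class(1)[OF assms(1), of l] label_class(2)[OF assms(1), of _ l]
    label_class(3)[OF assms(1), of l]] assms(2)
  unfolding label_involution_def by blast

lemma label_involution_fixed:
  assumes "labelled_multigraph L \<Gamma>" "\<And>e. (l, e) \<in> edges \<Gamma> \<Longrightarrow> a \<notin> e"
  shows "label_involution \<Gamma> l a = a"
  using fold_edge_transposition[OF label_class(1)[OF assms(1), of l] label_class(2)[OF assms(1), of _ l]
    label_class(3)[OF assms(1), of l]] assms(2)
  unfolding label_involution_def by blast

end

theory Submission
  imports Defs
begin

text \<open>
  The only generator of a pendant graph that moves \<open>A\<close> is a transposition, so the points \<open>x\<close> for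
  which \<open>(A x)\<close> lies in the group of a set \<open>I\<close> of labels form an invariant set, namely the orbit
  of \<open>A\<close>, and the group contains the full symmetric group of this orbit. After gluing, the orbit
  \<open>O\<^sub>I\<close> of \<open>C\<close> is the union of the orbits on the two sides, and the intersection property of both
  sides gives \<open>O\<^sub>I \<inter> O\<^sub>J = O\<^bsub>I\<inter>J\<^esub>\<close>. Let \<open>g\<close> lie in the groups of both \<open>I\<close> and \<open>J\<close>.
  Up to an element of \<open>Sym O\<^bsub>I\<inter>J\<^esub>\<close>, which is contained in the group of \<open>I \<inter> J\<close>, \<open>g\<close> fixes
  \<open>O\<^bsub>I\<inter>J\<^esub>\<close> pointwise. A point outside \<open>O\<^sub>I\<close> stays on its side because \<open>g\<close> is in the group
  of \<open>I\<close>, and likewise for \<open>J\<close>; so \<open>g\<close> preserves both sides. On each side it agrees off the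
  orbit of \<open>C\<close> with an element of the one-sided group, and the rest is absorbed by the symmetric
  group of the orbit, so the intersection property of each side applies to the restrictions of \<open>g\<close>.
\<close>

section \<open>Spans of involutions\<close>

text \<open>This is the monoid generated by \<open>S\<close> under composition. In the applications
  \<open>S\<close> consists of involutions, so it is also the generated group, and inductions need
  only treat left multiplication by one generator, without an inverse case.\<close>

inductive_set perm_span :: "('v \<Rightarrow> 'v) set \<Rightarrow> ('v \<Rightarrow> 'v) set" for S where
  id: "id \<in> perm_span S"
| comp: "s \<in> S \<Longrightarrow> g \<in> perm_span S \<Longrightarrow> s \<circ> g \<in> perm_span S"

lemma perm_span_incl: "s \<in> S \<Longrightarrow> s \<in> perm_span S"
  using perm_span.comp[OF _ perm_span.id] by simp

lemma perm_span_comp: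
  assumes "g \<in> perm_span S" "h \<in> perm_span S"
  shows "g \<circ> h \<in> perm_span S"
  using assms by induction (simp_all add: perm_span.comp comp_assoc)

lemma perm_span_mono:
  assumes "S \<subseteq> T"
  shows "perm_span S \<subseteq> perm_span T"
proof
  fix g assume "g \<in> perm_span S"
  then show "g \<in> perm_span T"
    using assms by induction (auto intro: perm_span.intros)
qed

lemma involution_inv: "s \<circ> s = id \<Longrightarrow> inv_into UNIV s = s"
  by (simp add: inv_unique_comp)

lemma involution_permutes:
  assumes "s \<circ> s = id" "\<And>x. x \<notin> V \<Longrightarrow> s x = x"
  shows "s permutes V"
proof -
  have "s (s x) = x" for x using assms(1) by (metis comp_apply id_apply)
  then show ?thesis unfolding permutes_def using assms(2) by metis
qed

lemma perm_span_bij: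
  assumes "\<And>s. s \<in> S \<Longrightarrow> s \<circ> s = id" "g \<in> perm_span S"
  shows "bij g"
  using assms(2)
proof induction
  case (comp s g)
  then show ?case using assms(1) by (metis bij_comp o_bij)
qed (rule bij_id)

text \<open>Reversing a word of involutions inverts it; hence the monoid span of involutions is a
  group.\<close>

lemma perm_span_inv:
  assumes "\<And>s. s \<in> S \<Longrightarrow> s \<circ> s = id" "g \<in> perm_span S"
  shows "inv_into UNIV g \<in> perm_span S"
  using assms(2)
proof induction
  case (comp s g)
  have "inv_into UNIV (s \<circ> g) = inv_into UNIV g \<circ> s"
    using comp assms(1) by (metis o_inv_distrib o_bij perm_span_bij involution_inv)
  with comp show ?case by (metis perm_span_comp perm_span_incl)
qed (simp add: perm_span.id del: id_apply)

lemma perm_span_invariant: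
  assumes "g \<in> perm_span S" "\<And>s x. s \<in> S \<Longrightarrow> x \<in> W \<Longrightarrow> s x \<in> W" "x \<in> W"
  shows "g x \<in> W"
  using assms(1) by induction (simp_all add: assms)

lemma perm_span_permutes:
  assumes "g \<in> perm_span S" "\<And>s. s \<in> S \<Longrightarrow> s permutes V"
  shows "g permutes V"
  using assms(1) by induction (blast intro: permutes_id permutes_compose assms(2))+

text \<open>Conjugation by an involution is multiplicative, since the two inner copies of
  \<open>f\<close> cancel. This carries spans along a renaming of vertices.\<close>

lemma perm_span_conj:
  assumes "f \<circ> f = id"
  shows "perm_span ((\<lambda>s. f \<circ> s \<circ> f) ` S) = (\<lambda>g. f \<circ> g \<circ> f) ` perm_span S"
proof (intro equalityI subsetI)
  have ff: "f (f x) = x" for x using assms by (metis comp_apply id_apply)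
  fix g assume "g \<in> perm_span ((\<lambda>s. f \<circ> s \<circ> f) ` S)"
  then show "g \<in> (\<lambda>g. f \<circ> g \<circ> f) ` perm_span S"
  proof induction
    case id
    show ?case by (rule image_eqI[OF _ perm_span.id]) (simp add: assms)
  next
    case (comp s g)
    then obtain t h where "t \<in> S" "s = f \<circ> t \<circ> f" "h \<in> perm_span S" "g = f \<circ> h \<circ> f" by blast
    then show ?case
      by (intro image_eqI[OF _ perm_span.comp[of t S h]]) (auto simp: fun_eq_iff ff)
  qed
next
  have ff: "f (f x) = x" for x using assms by (metis comp_apply id_apply)
  fix g assume "g \<in> (\<lambda>g. f \<circ> g \<circ> f) ` perm_span S"
  then obtain h where h: "h \<in> perm_span S" "g = f \<circ> h \<circ> f" by blast
  from h(1) have "f \<circ> h \<circ> f \<in> perm_span ((\<lambda>s. f \<circ> s \<circ> f) ` S)"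
  proof induction
    case id
    show ?case using perm_span.id[of "(\<lambda>s. f \<circ> s \<circ> f) ` S"] assms by (metis comp_id)
  next
    case (comp s g)
    have "f \<circ> (s \<circ> g) \<circ> f = (f \<circ> s \<circ> f) \<circ> (f \<circ> g \<circ> f)" by (auto simp: fun_eq_iff ff)
    with comp show ?case by (metis perm_span.comp imageI)
  qed
  with h show "g \<in> perm_span ((\<lambda>s. f \<circ> s \<circ> f) ` S)" by simp
qed

lemma permutes_restrict:
  assumes "inj g" "finite A" "\<And>x. x \<in> A \<Longrightarrow> g x \<in> A"
  shows "(\<lambda>x. if x \<in> A then g x else x) permutes A"
proof (rule bij_imp_permutes)
  have "inj_on g A" using assms(1) by (rule inj_on_subset) simp
  moreover have "g ` A \<subseteq> A" using assms(3) by blast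
  ultimately have "bij_betw g A A" using assms(2) by (simp add: bij_betw_def endo_inj_surj)
  then show "bij_betw (\<lambda>x. if x \<in> A then g x else x) A A"
    by (rule bij_betw_cong[THEN iffD1, rotated]) simp
qed simp

section \<open>Involutions moving a point only by transpositions\<close>

text \<open>This isolates what the group argument takes from a pendant vertex, with
  \<open>s C\<close> in place of the neighbour of \<open>C\<close>. Unlike pendancy itself, the
  condition survives the union of the two sides, where \<open>C\<close> has two neighbours.\<close>

definition pendant_set :: "'v \<Rightarrow> 'v set \<Rightarrow> ('v \<Rightarrow> 'v) set \<Rightarrow> bool" where
  "pendant_set C V S \<longleftrightarrow>
     (\<forall>s\<in>S. s permutes V \<and> s \<circ> s = id \<and> (s C \<noteq> C \<longrightarrow> s = transpose C (s C)))"

text \<open>For a pendant set this is the orbit of \<open>C\<close>: the span induces the full symmetric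
  group on it.\<close>

definition pendant_orbit :: "'v \<Rightarrow> ('v \<Rightarrow> 'v) set \<Rightarrow> 'v set" where
  "pendant_orbit C S = {x. transpose C x \<in> perm_span S}"

lemma pendant_set_subset: "pendant_set C V S \<Longrightarrow> T \<subseteq> S \<Longrightarrow> pendant_set C V T"
  unfolding pendant_set_def by blast

lemma pendant_set_Un:
  assumes "pendant_set C V S" "pendant_set C W T"
  shows "pendant_set C (V \<union> W) (S \<union> T)"
  using assms unfolding pendant_set_def by (meson Un_iff Un_upper1 Un_upper2 permutes_subset)

lemma pendant_orbit_self: "C \<in> pendant_orbit C S"
  by (simp add: pendant_orbit_def perm_span.id)

lemma pendant_orbit_mono: "S \<subseteq> T \<Longrightarrow> pendant_orbit C S \<subseteq> pendant_orbit C T"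
  unfolding pendant_orbit_def using perm_span_mono by blast

lemma pendant_orbit_subset:
  assumes "pendant_set C V S" "C \<in> V"
  shows "pendant_orbit C S \<subseteq> V"
proof
  fix x assume "x \<in> pendant_orbit C S"
  then have "transpose C x permutes V"
    unfolding pendant_orbit_def using perm_span_permutes assms(1)
    by (metis mem_Collect_eq pendant_set_def)
  then show "x \<in> V" using assms(2) by (metis permutes_in_image transpose_apply_first)
qed

text \<open>If \<open>s\<close> fixes \<open>C\<close>, conjugating (C x) by \<open>s\<close> gives
  (C s(x)). Otherwise \<open>s\<close> is itself a transposition (C c) of the span, and it sends
  \<open>x\<close> to \<open>C\<close>, to \<open>c\<close> or to \<open>x\<close>.\<close>

lemma pendant_orbit_step:
  assumes "pendant_set C V S" "s \<in> S" "x \<in> pendant_orbit C S"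
  shows "s x \<in> pendant_orbit C S"
proof (cases "s C = C")
  case True
  have ss: "s (s y) = y" for y
    using assms unfolding pendant_set_def by (metis comp_apply id_apply)
  have "transpose C (s x) = s \<circ> transpose C x \<circ> s"
    using True ss by (fastforce simp: fun_eq_iff transpose_def)
  then show ?thesis using assms(2,3)
    by (simp add: pendant_orbit_def perm_span_comp perm_span_incl)
next
  case False
  then have s: "s = transpose C (s C)" using assms unfolding pendant_set_def by blast
  then have "s C \<in> pendant_orbit C S"
    using assms(2) perm_span_incl by (fastforce simp: pendant_orbit_def)
  then show ?thesis
    using s assms(3) pendant_orbit_self by (metis transpose_def)
qed

lemma pendant_orbit_span:
  assumes "pendant_set C V S" "g \<in> perm_span S" "x \<in> pendant_orbit C S"
  shows "g x \<in> pendant_orbit C S"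
  using assms(2) by (rule perm_span_invariant) (rule pendant_orbit_step[OF assms(1)], assumption+, rule assms(3))

lemma pendant_orbit_step_iff:
  assumes "pendant_set C V S" "s \<in> S"
  shows "s x \<in> pendant_orbit C S \<longleftrightarrow> x \<in> pendant_orbit C S"
  using pendant_orbit_step[OF assms] assms unfolding pendant_set_def
  by (metis comp_apply id_apply)

text \<open>The transpositions (C x) with \<open>x\<close> in the orbit form a star, and a star
  generates the full symmetric group because (a b) = (C a)(C b)(C a).\<close>

lemma Sym_pendant_orbit:
  assumes "p permutes W" "finite W" "W \<subseteq> pendant_orbit C S"
  shows "p \<in> perm_span S"
  using assms(1,2)
proof (induction rule: permutes_induct)
  case id
  show ?case by (rule perm_span.id)
next
  case (swap a b p)
  have ab: "transpose C a \<in> perm_span S" "transpose C b \<in> perm_span S"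
    using swap assms(3) by (auto simp: pendant_orbit_def)
  have "transpose a b \<in> perm_span S"
  proof (cases "a = C \<or> b = C")
    case True
    then show ?thesis using ab by (auto simp: transpose_commute)
  next
    case False
    then have "transpose a b = transpose C a \<circ> transpose C b \<circ> transpose C a"
      using swap by (auto simp: fun_eq_iff transpose_def)
    then show ?thesis using ab by (simp add: perm_span_comp)
  qed
  then show ?case using swap.IH by (rule perm_span_comp)
qed

section \<open>Two pendant sets sharing a point\<close>

text \<open>The union of the two orbits is closed under all generators: a generator of one side
  preserves the orbit on its own side and fixes the other side outside \<open>C\<close>, while
  \<open>C\<close> lies in both orbits.\<close>

lemma pendant_orbit_Un:
  assumes S: "pendant_set C V S" and T: "pendant_set C W T" and VW: "V \<inter> W = {C}"
  shows "pendant_orbit C (S \<union> T) = pendant_orbit C S \<union> pendant_orbit C T"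
proof
  show "pendant_orbit C S \<union> pendant_orbit C T \<subseteq> pendant_orbit C (S \<union> T)"
    by (simp add: pendant_orbit_mono)
  have sub: "pendant_orbit C S \<subseteq> V" "pendant_orbit C T \<subseteq> W"
    using pendant_orbit_subset[OF S] pendant_orbit_subset[OF T] VW by auto
  have step: "s x \<in> pendant_orbit C S \<union> pendant_orbit C T"
    if "s \<in> S \<union> T" "x \<in> pendant_orbit C S \<union> pendant_orbit C T" for s x
  proof -
    have "s x \<in> pendant_orbit C S" if "s \<in> S" "x \<in> pendant_orbit C S"
      using pendant_orbit_step[OF S that] .
    moreover have "s x \<in> pendant_orbit C T" if "s \<in> T" "x \<in> pendant_orbit C T"
      using pendant_orbit_step[OF T that] .
    moreover have "s x = x" if "s \<in> S" "x \<in> W" "x \<noteq> C"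
      using S that VW unfolding pendant_set_def by (metis IntI permutes_not_in singletonD)
    moreover have "s x = x" if "s \<in> T" "x \<in> V" "x \<noteq> C"
      using T that VW unfolding pendant_set_def by (metis IntI permutes_not_in singletonD)
    moreover have "C \<in> pendant_orbit C S" "C \<in> pendant_orbit C T"
      by (rule pendant_orbit_self)+
    ultimately show ?thesis using that sub by (cases "x = C") auto
  qed
  show "pendant_orbit C (S \<union> T) \<subseteq> pendant_orbit C S \<union> pendant_orbit C T"
  proof
    fix x assume "x \<in> pendant_orbit C (S \<union> T)"
    then have "transpose C x \<in> perm_span (S \<union> T)" by (simp add: pendant_orbit_def)
    \<comment> \<open>Following the point \<open>C\<close> under the group element
      \<open>transpose C x\<close> shows that \<open>x\<close> itself lies in the closed
      set.\<close>
    then have "transpose C x C \<in> pendant_orbit C S \<union> pendant_orbit C T"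
      by (rule perm_span_invariant) (use step pendant_orbit_self in auto)
    then show "x \<in> pendant_orbit C S \<union> pendant_orbit C T" by simp
  qed
qed

text \<open>Off the orbit of \<open>C\<close> the generators in \<open>T\<close> have no effect on
  \<open>V\<close>, so there \<open>g\<close> agrees with a word in \<open>S\<close>. On the orbit,
  whatever \<open>g\<close> does is available in the span of \<open>S\<close>, which contains the
  full symmetric group of the orbit.\<close>

lemma perm_span_Un_restrict:
  assumes S: "pendant_set C V S" and T: "pendant_set C W T" and VW: "V \<inter> W = {C}"
    and fin: "finite V"
    and g: "g \<in> perm_span (S \<union> T)" and gX: "\<And>x. x \<in> V \<Longrightarrow> g x \<in> V"
  shows "(\<lambda>x. if x \<in> V then g x else x) \<in> perm_span S"
proof -
  let ?O = "pendant_orbit C S"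
  have OX: "?O \<subseteq> V" using pendant_orbit_subset[OF S] VW by blast
  have perm: "s permutes V" "s \<circ> s = id" if "s \<in> S" for s
    using S that by (auto simp: pendant_set_def)
  have invar: "h x \<in> V - ?O" if "h \<in> perm_span S" "x \<in> V - ?O" for h x
    using that(1)
  proof (rule perm_span_invariant)
    show "s y \<in> V - ?O" if "s \<in> S" "y \<in> V - ?O" for s y
      using pendant_orbit_step_iff[OF S that(1)] that(2) permutes_in_image[OF perm(1)[OF that(1)]]
      by simp
  qed (rule that(2))
  \<comment> \<open>The word for \<open>g\<close> is stripped of its letters outside
    \<open>S\<close>. Agreement is claimed only off the orbit because the intermediate words need
    not map \<open>V\<close> to itself: points of the orbit may leave \<open>V\<close> through
    \<open>C\<close> and return.\<close>
  have "\<exists>a\<in>perm_span S. \<forall>x\<in>V - ?O. g x = a x"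
    using g
  proof induction
    case id
    show ?case using perm_span.id by blast
  next
    case (comp s g)
    then obtain a where a: "a \<in> perm_span S" "\<forall>x\<in>V - ?O. g x = a x" by blast
    show ?case
    proof (cases "s \<in> S")
      case True
      then show ?thesis using a by (intro bexI[of _ "s \<circ> a"]) (auto intro: perm_span.comp)
    next
      case False
      then have "s permutes W" using comp T by (auto simp: pendant_set_def)
      then have "s y = y" if "y \<in> V - ?O" for y
        using that VW pendant_orbit_self[of C S] by (metis DiffE IntI permutes_def singletonD)
      then show ?thesis using a invar by (intro bexI[of _ a]) auto
    qed
  qed
  then obtain a where a: "a \<in> perm_span S" "\<And>x. x \<in> V - ?O \<Longrightarrow> g x = a x" by blast
  let ?h = "\<lambda>x. if x \<in> V then g x else x"
  have invol: "s \<circ> s = id" if "s \<in> S \<union> T" for s using that S T by (auto simp: pendant_set_def)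
  have "inj g" using perm_span_bij[OF invol g] by (simp add: bij_is_inj)
  then have hX: "?h permutes V" using fin gX by (rule permutes_restrict)
  have aX: "a permutes V" using perm_span_permutes[OF a(1)] perm(1) .
  have ia: "inv_into UNIV a \<in> perm_span S" using perm_span_inv[OF _ a(1)] perm(2) .
  \<comment> \<open>Dividing by \<open>a\<close> leaves a permutation that is trivial off the orbit,
    hence an element of the symmetric group of the orbit.\<close>
  have "?h \<circ> inv_into UNIV a permutes V" using hX aX by (simp add: permutes_compose permutes_inv)
  moreover have "(?h \<circ> inv_into UNIV a) x = x" if "x \<in> V - ?O" for x
    using invar[OF ia that] a(2) permutes_inverses(1)[OF aX] by simp
  ultimately have "?h \<circ> inv_into UNIV a permutes ?O"
    by (rule permutes_superset)
  then have "?h \<circ> inv_into UNIV a \<in> perm_span S"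
    using Sym_pendant_orbit[of _ ?O C S] OX fin by (blast intro: finite_subset)
  then have "(?h \<circ> inv_into UNIV a) \<circ> a \<in> perm_span S" using a(1) by (rule perm_span_comp)
  then show ?thesis using permutes_inv_o(2)[OF aX] by (simp add: comp_assoc)
qed

text \<open>This is the intersection property of the glued group for one pair of label sets.
  \<open>K\<close> and \<open>K'\<close> will come from the common labels on each side, but enter
  only through their spans.\<close>

lemma perm_span_Un_Int:
  assumes fin: "finite V" "finite W" and VW: "V \<inter> W = {C}"
    and P: "pendant_set C V I" "pendant_set C V J" "pendant_set C V K"
    and Q: "pendant_set C W I'" "pendant_set C W J'" "pendant_set C W K'"
    and K: "perm_span I \<inter> perm_span J = perm_span K"
    and K': "perm_span I' \<inter> perm_span J' = perm_span K'"
  shows "perm_span (I \<union> I') \<inter> perm_span (J \<union> J') = perm_span (K \<union> K')"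
proof (intro equalityI subsetI)
  \<comment> \<open>The hypotheses nest the span of \<open>K\<close> in those of \<open>I\<close>
    and \<open>J\<close>, not \<open>K\<close> itself in \<open>I\<close> and \<open>J\<close>.
    Monotonicity is therefore needed with spans in place of generating sets.\<close>
  have Un_sub: "perm_span (A \<union> A') \<subseteq> perm_span (B \<union> B')"
    if "perm_span A \<subseteq> perm_span B" "perm_span A' \<subseteq> perm_span B'" for A A' B B' :: "('a \<Rightarrow> 'a) set"
  proof
    fix g assume "g \<in> perm_span (A \<union> A')"
    then show "g \<in> perm_span (B \<union> B')"
    proof induction
      case (comp s g)
      then have "s \<in> perm_span B \<or> s \<in> perm_span B'" using that perm_span_incl by blast
      then have "s \<in> perm_span (B \<union> B')"
        using perm_span_mono[of B "B \<union> B'"] perm_span_mono[of B' "B \<union> B'"] by blast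
      then show ?case using comp.IH by (rule perm_span_comp)
    qed (rule perm_span.id)
  qed
  have KI: "perm_span (K \<union> K') \<subseteq> perm_span (I \<union> I')"
    and KJ: "perm_span (K \<union> K') \<subseteq> perm_span (J \<union> J')"
    using K K' by (intro Un_sub; blast)+
  show "g \<in> perm_span (I \<union> I') \<inter> perm_span (J \<union> J')" if "g \<in> perm_span (K \<union> K')" for g
    using that KI KJ by blast
  fix g assume gIJ: "g \<in> perm_span (I \<union> I') \<inter> perm_span (J \<union> J')"
  then have gI: "g \<in> perm_span (I \<union> I')" and gJ: "g \<in> perm_span (J \<union> J')" by auto
  note pI = pendant_set_Un[OF P(1) Q(1)] and pJ = pendant_set_Un[OF P(2) Q(2)]
  note pK = pendant_set_Un[OF P(3) Q(3)]
  let ?OI = "pendant_orbit C (I \<union> I')" and ?OJ = "pendant_orbit C (J \<union> J')"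
  let ?OK = "pendant_orbit C (K \<union> K')"
  have OI: "?OI = pendant_orbit C I \<union> pendant_orbit C I'" by (rule pendant_orbit_Un[OF P(1) Q(1) VW])
  have OJ: "?OJ = pendant_orbit C J \<union> pendant_orbit C J'" by (rule pendant_orbit_Un[OF P(2) Q(2) VW])
  have OK: "?OK = pendant_orbit C K \<union> pendant_orbit C K'" by (rule pendant_orbit_Un[OF P(3) Q(3) VW])
  have CX: "C \<in> V" "C \<in> W" using VW by auto
  \<comment> \<open>Membership in an orbit means that one transposition lies in a span, so the
    one-sided intersection equations pass directly to the orbits.\<close>
  have "pendant_orbit C I \<inter> pendant_orbit C J = pendant_orbit C K"
    using K by (auto simp: pendant_orbit_def)
  moreover have "pendant_orbit C I' \<inter> pendant_orbit C J' = pendant_orbit C K'"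
    using K' by (auto simp: pendant_orbit_def)
  \<comment> \<open>Orbits on opposite sides can meet only in \<open>C\<close>, which belongs to
    \<open>?OK\<close> anyway, so the cross terms add no points.\<close>
  moreover have "pendant_orbit C I \<inter> pendant_orbit C J' \<subseteq> {C}" "pendant_orbit C I' \<inter> pendant_orbit C J \<subseteq> {C}"
    using pendant_orbit_subset[OF P(1)] pendant_orbit_subset[OF P(2)] pendant_orbit_subset[OF Q(1)]
      pendant_orbit_subset[OF Q(2)] VW CX by blast+
  ultimately have OIJ: "?OI \<inter> ?OJ = ?OK"
    unfolding OI OJ OK using pendant_orbit_self[of C] by blast
  have finOK: "finite ?OK" using pendant_orbit_subset[OF pK] CX fin by (meson UnI1 finite_UnI finite_subset)
  have involI: "s \<circ> s = id" if "s \<in> I \<union> I'" for s using that pI by (auto simp: pendant_set_def)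
  have involJ: "s \<circ> s = id" if "s \<in> J \<union> J'" for s using that pJ by (auto simp: pendant_set_def)
  \<comment> \<open>\<open>?h\<close> is the action of \<open>g\<close> on \<open>?OK\<close>. The
    span of \<open>K \<union> K'\<close> contains the full symmetric group of \<open>?OK\<close>, so
    \<open>?h\<close> lies in it and can be divided out of \<open>g\<close>.\<close>
  let ?h = "\<lambda>x. if x \<in> ?OK then g x else x"
  have gOK: "g x \<in> ?OK" if "x \<in> ?OK" for x
    using that pendant_orbit_span[OF pI gI] pendant_orbit_span[OF pJ gJ] OIJ by blast
  have "inj g" using perm_span_bij[OF involI gI] by (simp add: bij_is_inj)
  then have hp: "?h permutes ?OK" using finOK gOK by (rule permutes_restrict)
  then have ihp: "inv_into UNIV ?h permutes ?OK" by (rule permutes_inv)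
  have h: "?h \<in> perm_span (K \<union> K')" using hp finOK order_refl by (rule Sym_pendant_orbit)
  have ih: "inv_into UNIV ?h \<in> perm_span (K \<union> K')" using ihp finOK order_refl by (rule Sym_pendant_orbit)
  define u where "u = g \<circ> inv_into UNIV ?h"
  have uI: "u \<in> perm_span (I \<union> I')" and uJ: "u \<in> perm_span (J \<union> J')"
    unfolding u_def using gI gJ ih KI KJ by (auto intro: perm_span_comp)
  have uOK: "u x = x" if "x \<in> ?OK" for x
  proof -
    have "inv_into UNIV ?h x \<in> ?OK" using ihp that by (simp add: permutes_in_image)
    then have "u x = ?h (inv_into UNIV ?h x)" by (simp add: u_def)
    then show ?thesis using permutes_inverses(1)[OF hp] by simp
  qed
  \<comment> \<open>Passing from one side to the other is possible only through \<open>C\<close>. A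
    point off the orbit never reaches \<open>C\<close>, so each generator either permutes the side
    of the point or fixes the point.\<close>
  have side: "h x \<in> Z - pendant_orbit C S"
    if "pendant_set C (V \<union> W) S" "Z = V \<or> Z = W" "\<And>s. s \<in> S \<Longrightarrow> s permutes V \<or> s permutes W"
      "h \<in> perm_span S" "x \<in> Z - pendant_orbit C S" for S Z h x
    using that(4)
  proof (rule perm_span_invariant)
    fix s y assume s: "s \<in> S" and y: "y \<in> Z - pendant_orbit C S"
    then have "y \<noteq> C" using pendant_orbit_self[of C S] by auto
    then have "s y \<in> Z"
      using that(2) that(3)[OF s] y VW by (metis DiffD1 IntI permutes_not_in permutes_in_image singletonD)
    then show "s y \<in> Z - pendant_orbit C S"
      using pendant_orbit_step_iff[OF that(1) s] y by blast
  qed (rule that(5))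
  have pI': "s permutes V \<or> s permutes W" if "s \<in> I \<union> I'" for s
    using that P Q by (auto simp: pendant_set_def)
  have pJ': "s permutes V \<or> s permutes W" if "s \<in> J \<union> J'" for s
    using that P Q by (auto simp: pendant_set_def)
  \<comment> \<open>Since \<open>?OI \<inter> ?OJ = ?OK\<close>, a point outside \<open>?OK\<close>
    lies off one of the two larger orbits, and membership of \<open>u\<close> in the corresponding
    span keeps it on its side.\<close>
  have uZ: "u x \<in> Z" if Z: "Z = V \<or> Z = W" and x: "x \<in> Z" for Z x
  proof -
    consider "x \<in> ?OK" | "x \<in> Z - ?OI" | "x \<in> Z - ?OJ" using OIJ x by blast
    then show ?thesis
    proof cases
      case 1
      then show ?thesis using uOK x by simp
    next
      case 2
      then show ?thesis using side[OF pI Z pI' uI] by blast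
    next
      case 3
      then show ?thesis using side[OF pJ Z pJ' uJ] by blast
    qed
  qed
  let ?u1 = "\<lambda>x. if x \<in> V then u x else x" and ?u2 = "\<lambda>x. if x \<in> W then u x else x"
  have WV: "W \<inter> V = {C}" using VW by blast
  have "?u1 \<in> perm_span I" "?u1 \<in> perm_span J"
    using perm_span_Un_restrict[OF P(1) Q(1) VW fin(1) uI] perm_span_Un_restrict[OF P(2) Q(2) VW fin(1) uJ] uZ
    by blast+
  then have u1: "?u1 \<in> perm_span (K \<union> K')" using K perm_span_mono[of K "K \<union> K'"] by blast
  have uI': "u \<in> perm_span (I' \<union> I)" and uJ': "u \<in> perm_span (J' \<union> J)"
    using uI uJ by (simp_all add: Un_commute)
  have "?u2 \<in> perm_span I'" "?u2 \<in> perm_span J'"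
    using perm_span_Un_restrict[OF Q(1) P(1) WV fin(2) uI'] perm_span_Un_restrict[OF Q(2) P(2) WV fin(2) uJ'] uZ
    by blast+
  then have u2: "?u2 \<in> perm_span (K \<union> K')" using K' perm_span_mono[of K' "K \<union> K'"] by blast
  have uXY: "u permutes V \<union> W" using perm_span_permutes[OF uI] pI by (auto simp: pendant_set_def)
  \<comment> \<open>Both sides are invariant and overlap only at \<open>C\<close>, which
    \<open>u\<close> fixes; hence no point is moved by both factors.\<close>
  have "u = ?u1 \<circ> ?u2"
  proof
    fix x
    have "u C = C" by (rule uOK[OF pendant_orbit_self])
    moreover have "u x \<in> W" if "x \<in> W" using uZ[of W x] that by simp
    ultimately show "u x = (?u1 \<circ> ?u2) x"
      using VW uXY unfolding permutes_def by (smt (verit) IntI Un_iff comp_apply singletonD)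
  qed
  then have "u \<in> perm_span (K \<union> K')" using perm_span_comp[OF u1 u2] by simp
  then have "u \<circ> ?h \<in> perm_span (K \<union> K')" using h by (rule perm_span_comp)
  moreover have "u \<circ> ?h = g" unfolding u_def using permutes_inv_o(2)[OF hp] by (simp add: comp_assoc)
  ultimately show "g \<in> perm_span (K \<union> K')" by simp
qed

section \<open>CPR graphs through spans\<close>

lemma labelled_multigraph_edge:
  assumes "labelled_multigraph L \<Gamma>" "(l, e) \<in> edges \<Gamma>"
  shows "l \<in> L" "e \<subseteq> verts \<Gamma>" "card e = 2"
  using assms unfolding labelled_multigraph_def by blast+

lemma label_involution_cases:
  assumes "labelled_multigraph L \<Gamma>"
  obtains b where "a \<noteq> b" "(l, {a, b}) \<in> edges \<Gamma>" "label_involution \<Gamma> l a = b"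
  | "\<And>e. (l, e) \<in> edges \<Gamma> \<Longrightarrow> a \<notin> e" "label_involution \<Gamma> l a = a"
proof (cases "\<exists>e. (l, e) \<in> edges \<Gamma> \<and> a \<in> e")
  case True
  then obtain e where e: "(l, e) \<in> edges \<Gamma>" "a \<in> e" by blast
  then have "card e = 2" using labelled_multigraph_edge(3)[OF assms] by blast
  then obtain b where "e = {a, b}" "a \<noteq> b" using e(2) by (metis card_2_iff doubleton_eq_iff insertE singletonD)
  then show ?thesis using that(1) e(1) label_involution_edge[OF assms] by blast
next
  case False
  then show ?thesis using that(2) label_involution_fixed[OF assms] by blast
qed

lemma label_involution_involution:
  assumes "labelled_multigraph L \<Gamma>"
  shows "label_involution \<Gamma> l \<circ> label_involution \<Gamma> l = id"
proof
  fix a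
  show "(label_involution \<Gamma> l \<circ> label_involution \<Gamma> l) a = id a"
  proof (cases rule: label_involution_cases[OF assms, of a l])
    case (1 b)
    then have "label_involution \<Gamma> l b = a"
      using label_involution_edge[OF assms, of l b a] by (simp add: insert_commute)
    with 1 show ?thesis by simp
  qed simp
qed

lemma label_involution_permutes:
  assumes "labelled_multigraph L \<Gamma>"
  shows "label_involution \<Gamma> l permutes verts \<Gamma>"
  using label_involution_involution[OF assms]
proof (rule involution_permutes)
  show "label_involution \<Gamma> l a = a" if "a \<notin> verts \<Gamma>" for a
    using label_involution_fixed[OF assms, of l a] labelled_multigraph_edge(2)[OF assms] that by blast
qed

lemma label_involution_neq_id:
  assumes "labelled_multigraph L \<Gamma>" "l \<in> L"
  shows "label_involution \<Gamma> l \<noteq> id"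
proof -
  have "\<exists>e. (l, e) \<in> edges \<Gamma>" using assms by (simp add: labelled_multigraph_def)
  then obtain e where e: "(l, e) \<in> edges \<Gamma>" ..
  then have "card e = 2" by (rule labelled_multigraph_edge(3)[OF assms(1)])
  then obtain a b where ab: "e = {a, b}" "a \<noteq> b" by (meson card_2_iff)
  then have "label_involution \<Gamma> l a = b" using label_involution_edge[OF assms(1)] e by simp
  with ab(2) show ?thesis by auto
qed

lemma group_Sym: "group (Sym \<Omega>)"
proof (rule groupI)
  fix p assume "p \<in> carrier (Sym \<Omega>)"
  then show "\<exists>q\<in>carrier (Sym \<Omega>). q \<otimes>\<^bsub>Sym \<Omega>\<^esub> p = \<one>\<^bsub>Sym \<Omega>\<^esub>"
    using permutes_inv[of p \<Omega>] permutes_inv_o(2)[of p \<Omega>] by (auto simp: Sym_def)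
qed (auto simp: Sym_def permutes_compose permutes_id comp_assoc)

text \<open>Since each element of \<open>T\<close> is its own inverse, the inverse clause of
  \<open>generate\<close> yields nothing new, and products are words in \<open>T\<close>.\<close>

lemma generate_Sym:
  assumes T: "\<And>t. t \<in> T \<Longrightarrow> t permutes \<Omega>" "\<And>t. t \<in> T \<Longrightarrow> t \<circ> t = id"
  shows "generate (Sym \<Omega>) T = perm_span T"
proof -
  interpret group "Sym \<Omega>" by (rule group_Sym)
  have mult: "x \<otimes>\<^bsub>Sym \<Omega>\<^esub> y = x \<circ> y" for x y by (simp add: Sym_def)
  have one: "\<one>\<^bsub>Sym \<Omega>\<^esub> = id" by (simp add: Sym_def)
  have inv_T: "inv\<^bsub>Sym \<Omega>\<^esub> t = t" if "t \<in> T" for t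
    using inv_equality[of t t] that T by (simp add: Sym_def)
  show ?thesis
  proof (intro equalityI subsetI)
    fix g assume "g \<in> generate (Sym \<Omega>) T"
    then show "g \<in> perm_span T"
    proof induction
      case one
      show ?case unfolding \<open>\<one>\<^bsub>Sym \<Omega>\<^esub> = id\<close> by (rule perm_span.id)
    next
      case (incl h)
      then show ?case by (rule perm_span_incl)
    next
      case (inv h)
      then show ?case unfolding inv_T[OF inv] by (rule perm_span_incl)
    next
      case (eng g h)
      from eng.IH show ?case unfolding mult by (rule perm_span_comp)
    qed
  next
    fix g assume "g \<in> perm_span T"
    then show "g \<in> generate (Sym \<Omega>) T"
    proof induction
      case id
      show ?case using generate.one[of "Sym \<Omega>" T] unfolding one .
    next
      case (comp s g)
      from generate.eng[OF generate.incl[OF comp.hyps(1)] comp.IH]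
      show ?case unfolding mult .
    qed
  qed
qed

lemma sorted_list_of_set_int: "sorted_list_of_set {m..n} = [m..n]" for m n :: int
  by (metis set_upto distinct_upto sorted_list_of_set.idem_if_sorted_distinct sorted_upto)

text \<open>The list-based definition becomes a statement about sets of labels: involutivity,
  nontriviality and generation are automatic for a labelled multigraph, (pq)^2 = 1 is commutation,
  and list positions are labels shifted by the least label.\<close>

lemma CPR_graph_iff:
  "CPR_graph L \<Gamma> \<longleftrightarrow>
     labelled_multigraph L \<Gamma> \<and>
     (\<forall>i\<in>L. \<forall>j\<in>L. \<bar>i - j\<bar> \<ge> 2 \<longrightarrow>
        label_involution \<Gamma> i \<circ> label_involution \<Gamma> j = label_involution \<Gamma> j \<circ> label_involution \<Gamma> i) \<and>
     (\<forall>I J. I \<subseteq> L \<and> J \<subseteq> L \<longrightarrow>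
        perm_span (label_involution \<Gamma> ` I) \<inter> perm_span (label_involution \<Gamma> ` J) =
        perm_span (label_involution \<Gamma> ` (I \<inter> J)))"
proof (cases "labelled_multigraph L \<Gamma>")
  case True
  let ?\<rho> = "label_involution \<Gamma>"
  let ?H = "subgroup_generated (Sym (verts \<Gamma>)) (?\<rho> ` L)"
  let ?s = "label_sequence L \<Gamma>"
  have "\<exists>m n. L = {m..n}" using True by (simp add: labelled_multigraph_def)
  then obtain m n where L: "L = {m..n}" by (elim exE)
  \<comment> \<open>\<open>L\<close> is an interval starting at \<open>m\<close>, so its sorted list
    has the label \<open>m + i\<close> at position \<open>i\<close>; this shift preserves distances
    between labels.\<close>
  define lab where "lab i = m + int i" for i :: nat
  define N where "N = length ?s"
  have len: "N = nat (n - m + 1)"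
    by (simp add: N_def label_sequence_def L sorted_list_of_set_int)
  have nth: "?s ! i = ?\<rho> (lab i)" if "i < N" for i
    using that len by (simp add: label_sequence_def L sorted_list_of_set_int lab_def)
  have lab: "L = lab ` {..<N}"
  proof
    show "lab ` {..<N} \<subseteq> L" using len by (auto simp: L lab_def)
    show "L \<subseteq> lab ` {..<N}"
    proof
      fix l assume "l \<in> L"
      then show "l \<in> lab ` {..<N}"
        using len by (intro image_eqI[of _ _ "nat (l - m)"]) (auto simp: L lab_def)
    qed
  qed
  have inj: "inj lab" by (simp add: inj_on_def lab_def)
  have set: "set ?s = ?\<rho> ` L" by (simp add: label_sequence_def L)
  have nth_image: "(!) ?s ` I = ?\<rho> ` lab ` I" if "I \<subseteq> {..<N}" for I
    using that nth by (auto simp: image_image intro!: image_cong)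
  have invol: "?\<rho> l \<circ> ?\<rho> l = id" for l using label_involution_involution[OF True] .
  have \<rho>_Sym: "?\<rho> ` L \<subseteq> carrier (Sym (verts \<Gamma>))"
    using label_involution_permutes[OF True] by (auto simp: Sym_def)
  have gen_Sym: "generate (Sym (verts \<Gamma>)) T = perm_span T" if "T \<subseteq> ?\<rho> ` L" for T
    by (rule generate_Sym) (use that label_involution_permutes[OF True] invol in auto)
  have carrier: "carrier ?H = perm_span (?\<rho> ` L)"
    using gen_Sym[of "?\<rho> ` L"] \<rho>_Sym by (simp add: carrier_subgroup_generated Int_absorb1)
  \<comment> \<open>Generation may be computed in the ambient symmetric group, because the
    generators lie in the subgroup.\<close>
  have gen: "generate ?H T = perm_span T" if "T \<subseteq> ?\<rho> ` L" for T
  proof -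
    interpret group "Sym (verts \<Gamma>)" by (rule group_Sym)
    have "generate ?H T = generate (Sym (verts \<Gamma>)) T"
      unfolding subgroup_generated_def using \<rho>_Sym that
      by (intro generate_consistent generate_is_subgroup) (blast intro: generate.incl)+
    then show ?thesis using gen_Sym[OF that] by simp
  qed
  have gen_nth: "generate ?H ((!) ?s ` I) = perm_span (?\<rho> ` lab ` I)" if "I \<subseteq> {..<N}" for I
    unfolding nth_image[OF that] using that lab by (intro gen image_mono) blast
  have commute: "(p \<otimes>\<^bsub>?H\<^esub> q) [^]\<^bsub>?H\<^esub> (2::nat) = \<one>\<^bsub>?H\<^esub> \<longleftrightarrow> p \<circ> q = q \<circ> p"
    if "p \<circ> p = id" "q \<circ> q = id" for p q
  proof -
    have "(p \<otimes>\<^bsub>?H\<^esub> q) [^]\<^bsub>?H\<^esub> (2::nat) = (p \<circ> q) \<circ> (p \<circ> q)"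
      by (simp add: numeral_2_eq_2 nat_pow_def Sym_def)
    moreover have "(p \<circ> q) \<circ> (p \<circ> q) = id \<longleftrightarrow> p \<circ> q = q \<circ> p"
      using that by (metis comp_assoc comp_id id_comp)
    ultimately show ?thesis by (simp add: Sym_def)
  qed
  have "sggi ?H ?s \<longleftrightarrow> (\<forall>i<N. \<forall>j<N. \<bar>int i - int j\<bar> \<ge> 2 \<longrightarrow>
      ?\<rho> (lab i) \<circ> ?\<rho> (lab j) = ?\<rho> (lab j) \<circ> ?\<rho> (lab i))"
  proof -
    have "group ?H" by (rule group.group_subgroup_generated[OF group_Sym])
    moreover have "\<rho> \<in> carrier ?H \<and> \<rho> \<noteq> \<one>\<^bsub>?H\<^esub> \<and> \<rho> \<otimes>\<^bsub>?H\<^esub> \<rho> = \<one>\<^bsub>?H\<^esub>" if "\<rho> \<in> set ?s" for \<rho>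
    proof -
      from that obtain l where "l \<in> L" "\<rho> = ?\<rho> l" using set by blast
      then show ?thesis
        using carrier perm_span_incl[of \<rho> "?\<rho> ` L"] label_involution_neq_id[OF True] invol
        by (simp add: Sym_def)
    qed
    moreover have "generate ?H (set ?s) = carrier ?H" using gen[of "?\<rho> ` L"] set carrier by simp
    ultimately show ?thesis unfolding sggi_def N_def[symmetric] by (simp add: nth commute[OF invol invol, simplified])
  qed
  also have "\<dots> \<longleftrightarrow> (\<forall>i\<in>L. \<forall>j\<in>L. \<bar>i - j\<bar> \<ge> 2 \<longrightarrow> ?\<rho> i \<circ> ?\<rho> j = ?\<rho> j \<circ> ?\<rho> i)"
    unfolding lab by (auto simp: lab_def)
  finally have sggi: "sggi ?H ?s \<longleftrightarrow>
    (\<forall>i\<in>L. \<forall>j\<in>L. \<bar>i - j\<bar> \<ge> 2 \<longrightarrow> ?\<rho> i \<circ> ?\<rho> j = ?\<rho> j \<circ> ?\<rho> i)" .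
  \<comment> \<open>\<open>lab\<close> matches the index sets with the label sets and, being
    injective, respects intersections.\<close>
  have "(\<forall>I J. I \<subseteq> {..<N} \<and> J \<subseteq> {..<N} \<longrightarrow>
      generate ?H ((!) ?s ` I) \<inter> generate ?H ((!) ?s ` J) = generate ?H ((!) ?s ` (I \<inter> J))) \<longleftrightarrow>
    (\<forall>I J. I \<subseteq> L \<and> J \<subseteq> L \<longrightarrow>
      perm_span (?\<rho> ` I) \<inter> perm_span (?\<rho> ` J) = perm_span (?\<rho> ` (I \<inter> J)))"
    (is "?gen \<longleftrightarrow> ?span")
  proof
    assume gen: ?gen
    show ?span
    proof (intro allI impI, elim conjE)
      fix I J assume "I \<subseteq> L" "J \<subseteq> L"
      then obtain I' J' where I': "I' \<subseteq> {..<N}" "I = lab ` I'" and J': "J' \<subseteq> {..<N}" "J = lab ` J'"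
        unfolding lab subset_image_iff by blast
      then have "I' \<inter> J' \<subseteq> {..<N}" by blast
      with gen[rule_format, of I' J'] I' J'
      show "perm_span (?\<rho> ` I) \<inter> perm_span (?\<rho> ` J) = perm_span (?\<rho> ` (I \<inter> J))"
        by (simp add: gen_nth image_Int[OF inj])
    qed
  next
    assume span: ?span
    show ?gen
    proof (intro allI impI, elim conjE)
      fix I J assume IJ: "I \<subseteq> {..<N}" "J \<subseteq> {..<N}"
      then have "I \<inter> J \<subseteq> {..<N}" "lab ` I \<subseteq> L" "lab ` J \<subseteq> L" using lab by auto
      with span[rule_format, of "lab ` I" "lab ` J"] IJ
      show "generate ?H ((!) ?s ` I) \<inter> generate ?H ((!) ?s ` J) = generate ?H ((!) ?s ` (I \<inter> J))"
        by (simp add: gen_nth image_Int[OF inj])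
    qed
  qed
  with sggi show ?thesis
    unfolding CPR_graph_def string_C_group_def N_def using True by (simp only: simp_thms)
qed (simp add: CPR_graph_def)

section \<open>Relabelling and gluing\<close>

text \<open>Renaming by \<open>f\<close> carries the edges labelled \<open>l\<close> to those
  labelled \<open>l'\<close>, so the two involutions are conjugate by \<open>f\<close>, which is its
  own inverse.\<close>

lemma label_involution_relabel:
  assumes "labelled_multigraph L \<Gamma>" "labelled_multigraph L' \<Gamma>'" and f: "f \<circ> f = id"
    and edges: "\<And>e. (l', e) \<in> edges \<Gamma>' \<longleftrightarrow> (\<exists>e'. (l, e') \<in> edges \<Gamma> \<and> e = f ` e')"
  shows "label_involution \<Gamma>' l' = f \<circ> label_involution \<Gamma> l \<circ> f"
proof
  fix x
  have ff: "f (f y) = y" for y using f by (metis comp_apply id_apply)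
  show "label_involution \<Gamma>' l' x = (f \<circ> label_involution \<Gamma> l \<circ> f) x"
  proof (cases rule: label_involution_cases[OF assms(1), of "f x" l])
    case (1 b)
    then have "(l', f ` {f x, b}) \<in> edges \<Gamma>'" using edges by blast
    then have "label_involution \<Gamma>' l' x = f b"
      using label_involution_edge[OF assms(2)] ff by simp
    with 1 show ?thesis by simp
  next
    case 2
    have "x \<notin> e" if "(l', e) \<in> edges \<Gamma>'" for e
      using that 2(1) edges ff by fastforce
    then have "label_involution \<Gamma>' l' x = x" by (rule label_involution_fixed[OF assms(2)])
    with 2 show ?thesis by (simp add: ff)
  qed
qed

text \<open>The edge at \<open>A\<close> is the only edge of label 0, so its involution is a single
  transposition; every other label leaves \<open>A\<close> untouched. The whole range may be taken
  because a label without edges gives the identity.\<close>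

lemma pendant_zero_vertex_pendant_set:
  assumes \<Gamma>: "labelled_multigraph L \<Gamma>" and "pendant_zero_vertex \<Gamma> A"
  shows "l \<noteq> 0 \<Longrightarrow> label_involution \<Gamma> l A = A"
    and "pendant_set A (verts \<Gamma>) (range (label_involution \<Gamma>))"
proof -
  from assms(2) obtain e where e: "{(l, e'). (l, e') \<in> edges \<Gamma> \<and> A \<in> e'} = {(0, e)}"
    and other: "\<forall>(l, e')\<in>edges \<Gamma> - {(0, e)}. l \<ge> 1"
    unfolding pendant_zero_vertex_def by blast
  have A: "(l, e') \<in> edges \<Gamma> \<and> A \<in> e' \<longleftrightarrow> l = 0 \<and> e' = e" for l e'
    using e by (auto simp: set_eq_iff)
  have zero: "e' = e" if "(0, e') \<in> edges \<Gamma>" for e'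
  proof (rule ccontr)
    assume "e' \<noteq> e"
    with that have "(0, e') \<in> edges \<Gamma> - {(0, e)}" by simp
    from bspec[OF other this] show False by simp
  qed
  show fixed: "label_involution \<Gamma> l A = A" if "l \<noteq> 0" for l
    using label_involution_fixed[OF \<Gamma>, of l A] A that by blast
  have e0: "(0, e) \<in> edges \<Gamma>" "A \<in> e" using A by auto
  then have "card e = 2" using labelled_multigraph_edge(3)[OF \<Gamma>] by blast
  then obtain a where a: "e = {A, a}" "a \<noteq> A"
    using e0(2) by (metis card_2_iff doubleton_eq_iff insertE singletonD)
  have tr: "label_involution \<Gamma> 0 = transpose A a"
  proof
    fix x
    consider "x = A" | "x = a" | "x \<notin> e" using a by blast
    then show "label_involution \<Gamma> 0 x = transpose A a x"
    proof cases
      case 1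
      then show ?thesis using label_involution_edge[OF \<Gamma>, of 0 A a] e0 a by simp
    next
      case 2
      then show ?thesis using label_involution_edge[OF \<Gamma>, of 0 a A] e0 a by (simp add: insert_commute)
    next
      case 3
      then have "label_involution \<Gamma> 0 x = x"
        using label_involution_fixed[OF \<Gamma>, of 0 x] zero by blast
      then show ?thesis using 3 a by simp
    qed
  qed
  show "pendant_set A (verts \<Gamma>) (range (label_involution \<Gamma>))"
    unfolding pendant_set_def
  proof (intro ballI conjI impI)
    fix s assume "s \<in> range (label_involution \<Gamma>)"
    then obtain l where l: "s = label_involution \<Gamma> l" by blast
    show "s permutes verts \<Gamma>" unfolding l by (rule label_involution_permutes[OF \<Gamma>])
    show "s \<circ> s = id" unfolding l by (rule label_involution_involution[OF \<Gamma>])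
    assume "s A \<noteq> A"
    then have "l = 0" using fixed l by blast
    then show "s = transpose A (s A)" using tr l by simp
  qed
qed

text \<open>Conjugating (A x) by \<open>f\<close> gives the transposition of \<open>f A\<close> and
  \<open>f x\<close>, so the pendant condition follows the renaming.\<close>

lemma pendant_set_conj:
  assumes f: "f \<circ> f = id" and S: "pendant_set A V S"
  shows "pendant_set (f A) (f ` V) ((\<lambda>s. f \<circ> s \<circ> f) ` S)"
  unfolding pendant_set_def
proof (intro ballI conjI impI)
  have ff: "f (f y) = y" for y using f by (metis comp_apply id_apply)
  fix t assume "t \<in> (\<lambda>s. f \<circ> s \<circ> f) ` S"
  then obtain s where "s \<in> S" and t: "t = f \<circ> s \<circ> f" by blast
  with S have s: "s permutes V" "s \<circ> s = id" "s A \<noteq> A \<Longrightarrow> s = transpose A (s A)"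
    unfolding pendant_set_def by auto
  have ss: "s (s y) = y" for y using s(2) by (metis comp_apply id_apply)
  show tt: "t \<circ> t = id" by (simp add: t fun_eq_iff ff ss)
  show "t permutes f ` V"
    using tt
  proof (rule involution_permutes)
    fix x assume "x \<notin> f ` V"
    then have "f x \<notin> V" using ff by (metis imageI)
    then show "t x = x" using permutes_not_in[OF s(1)] by (simp add: t ff)
  qed
  assume "t (f A) \<noteq> f A"
  then have "s A \<noteq> A" by (auto simp: t ff)
  then have sA: "s y = transpose A (s A) y" for y using s(3) by metis
  show "t = transpose (f A) (t (f A))"
  proof
    fix x
    have "f x = A \<longleftrightarrow> x = f A" "f x = s A \<longleftrightarrow> x = f (s A)" using ff by metis+
    then show "t x = transpose (f A) (t (f A)) x"
      using sA[of "f x"] by (auto simp: t ff transpose_def)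
  qed
qed

text \<open>Conjugation by \<open>f\<close> is injective and commutes with taking spans, and
  \<open>h\<close> is injective on labels; both therefore respect intersections. This moves the
  intersection property of one graph to its copy inside the glued graph.\<close>

lemma perm_span_Int_relabel:
  assumes f: "f \<circ> f = id" and \<sigma>: "\<And>k. k \<in> K \<Longrightarrow> \<sigma> k = f \<circ> \<rho> (h k) \<circ> f"
    and h: "inj_on h K" "h ` K \<subseteq> L"
    and \<rho>: "\<And>I J. I \<subseteq> L \<Longrightarrow> J \<subseteq> L \<Longrightarrow> perm_span (\<rho> ` I) \<inter> perm_span (\<rho> ` J) = perm_span (\<rho> ` (I \<inter> J))"
    and IJ: "I \<subseteq> K" "J \<subseteq> K"
  shows "perm_span (\<sigma> ` I) \<inter> perm_span (\<sigma> ` J) = perm_span (\<sigma> ` (I \<inter> J))"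
proof -
  let ?c = "\<lambda>g. f \<circ> g \<circ> f"
  have ff: "f (f y) = y" for y using f by (metis comp_apply id_apply)
  have inj: "inj ?c" by (rule inj_on_inverseI[where g = ?c]) (simp add: fun_eq_iff ff)
  have span: "perm_span (\<sigma> ` M) = ?c ` perm_span (\<rho> ` h ` M)" if "M \<subseteq> K" for M
  proof -
    have "\<sigma> ` M = ?c ` \<rho> ` h ` M" unfolding image_image using \<sigma> that by (intro image_cong) auto
    then show ?thesis by (simp only: perm_span_conj[OF f])
  qed
  have "perm_span (\<sigma> ` I) \<inter> perm_span (\<sigma> ` J) = ?c ` (perm_span (\<rho> ` h ` I) \<inter> perm_span (\<rho> ` h ` J))"
    unfolding span[OF IJ(1)] span[OF IJ(2)] image_Int[OF inj] ..
  also have "\<dots> = ?c ` perm_span (\<rho> ` (h ` I \<inter> h ` J))"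
    by (intro arg_cong[of _ _ "image ?c"] \<rho>) (use h(2) IJ in blast)+
  also have "h ` I \<inter> h ` J = h ` (I \<inter> J)" using inj_on_image_Int[OF h(1) IJ] by simp
  also have "?c ` perm_span (\<rho> ` h ` (I \<inter> J)) = perm_span (\<sigma> ` (I \<inter> J))"
    by (rule span[symmetric]) (use IJ in blast)
  finally show ?thesis .
qed

lemma identify_commute: "identify A B C = identify B A C"
  by (auto simp: identify_def fun_eq_iff)

text \<open>Unlike \<open>identify\<close>, the transposition is an involution of the whole type, so
  generators can be conjugated by it. For \<open>C = A\<close> it is the identity.\<close>

lemma identify_eq_transpose:
  assumes "B \<notin> U" "C \<notin> U - {A}" "x \<in> U"
  shows "identify A B C x = transpose A C x"
  using assms by (auto simp: identify_def transpose_def)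

lemma transpose_image_replace:
  assumes "A \<in> U" "C \<notin> U - {A}"
  shows "transpose A C ` U = insert C (U - {A})"
proof -
  have "transpose A C ` (U - {A}) = U - {A}"
    using assms by (force simp: transpose_def image_iff)
  moreover have "U = insert A (U - {A})" using assms by blast
  ultimately show ?thesis by (metis image_insert transpose_apply_first)
qed

text \<open>If \<open>p\<close> fixes \<open>C\<close>, its support avoids \<open>W\<close> and so
  is disjoint from that of \<open>q\<close>; the other case is symmetric.\<close>

lemma permutes_commute_common_fixpoint:
  assumes "p permutes V" "q permutes W" "V \<inter> W = {C}" "p C = C \<or> q C = C"
  shows "p \<circ> q = q \<circ> p"
proof -
  have *: "p \<circ> q = q \<circ> p"
    if p: "p permutes V" and q: "q permutes W" and VW: "V \<inter> W = {C}" and C: "p C = C"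
    for p q :: "'a \<Rightarrow> 'a" and V W
  proof
    fix x
    have pW: "p y = y" if "y \<in> W" for y
      using permutes_not_in[OF p, of y] VW C that by (cases "y = C") auto
    show "(p \<circ> q) x = (q \<circ> p) x"
    proof (cases "x \<in> W")
      case True
      then have "q x \<in> W" using permutes_in_image[OF q] by blast
      with True pW show ?thesis by simp
    next
      case False
      have "p x \<notin> W"
      proof
        assume "p x \<in> W"
        then have "p (p x) = p x" by (rule pW)
        then have "p x = x" using permutes_inj[OF p] by (simp add: inj_eq)
        with \<open>p x \<in> W\<close> False show False by simp
      qed
      with False show ?thesis using permutes_not_in[OF q] by simp
    qed
  qed
  show ?thesis
    using *[OF assms(1-3)] *[OF assms(2,1)] assms(3,4) by (metis Int_commute)
qed

theorem theorem1p1: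
  fixes r r' :: nat
    and \<G> \<G>' :: "'v edge_labelled_graph"
    and A B C :: 'v
  assumes "r \<ge> 1" and "r' \<ge> 1"
    and "CPR_graph {0..int r - 1} \<G>" and "pendant_zero_vertex \<G> A"
    and "CPR_graph {0..int r' - 1} \<G>'" and "pendant_zero_vertex \<G>' B"
    and "verts \<G> \<inter> verts \<G>' = {}"
    and "C \<notin> (verts \<G> \<union> verts \<G>') - {A, B}"
  shows "CPR_graph {- int r..int r' - 1} (glue \<G> A \<G>' B C)"
proof -
  let ?L = "{- int r..int r' - 1}" and ?L1 = "{0..int r - 1}" and ?L2 = "{0..int r' - 1}"
  let ?H = "glue \<G> A \<G>' B C"
  let ?\<rho> = "label_involution \<G>" and ?\<rho>' = "label_involution \<G>'" and ?\<sigma> = "label_involution ?H"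
  \<comment> \<open>Each side is renamed by its own involution; \<open>V\<close> and
    \<open>W\<close> are the resulting vertex sets of the two halves of the glued graph.\<close>
  define f where "f = transpose A C"
  define f' where "f' = transpose B C"
  define V where "V = f ` verts \<G>"
  define W where "W = f' ` verts \<G>'"
  have ff: "f \<circ> f = id" "f' \<circ> f' = id" by (simp_all add: f_def f'_def)
  have injf: "inj f" "inj f'" by (simp_all add: f_def f'_def)
  have fC: "f A = C" "f' B = C" by (simp_all add: f_def f'_def)
  note G = assms(3)[unfolded CPR_graph_iff] and G' = assms(5)[unfolded CPR_graph_iff]
  have mG: "labelled_multigraph ?L1 \<G>" and mG': "labelled_multigraph ?L2 \<G>'"
    using G G' by blast+
  have AB: "A \<in> verts \<G>" "B \<in> verts \<G>'"
    using assms(4,6) by (simp_all add: pendant_zero_vertex_def)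
  \<comment> \<open>\<open>C\<close> may be \<open>A\<close>, \<open>B\<close> or a new point.
    Disjointness of the vertex sets shows that within each side it can only be the vertex being
    replaced.\<close>
  have side: "A \<notin> verts \<G>'" "B \<notin> verts \<G>" "C \<notin> verts \<G> - {A}" "C \<notin> verts \<G>' - {B}"
    using AB assms(7,8) by blast+
  have iden: "identify A B C ` e = f ` e" if "e \<subseteq> verts \<G>" for e
    unfolding f_def using identify_eq_transpose[OF side(2,3)] that by (intro image_cong) auto
  have iden': "identify A B C ` e = f' ` e" if "e \<subseteq> verts \<G>'" for e
    unfolding f'_def identify_commute[of A]
    using identify_eq_transpose[OF side(1,4)] that by (intro image_cong) auto
  have verts: "verts ?H = V \<union> W"
    by (simp add: glue_def image_Un iden iden' V_def W_def)
  have VW: "V \<inter> W = {C}"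
    unfolding V_def W_def f_def f'_def
      transpose_image_replace[OF AB(1) side(3)] transpose_image_replace[OF AB(2) side(4)]
    using assms(7) by blast
  have edges: "(k, e) \<in> edges ?H \<longleftrightarrow>
      (\<exists>e'. (- k - 1, e') \<in> edges \<G> \<and> e = f ` e') \<or> (\<exists>e'. (k, e') \<in> edges \<G>' \<and> e = f' ` e')" for k e
  proof -
    have "(\<exists>l e'. k = - (l + 1) \<and> e = identify A B C ` e' \<and> (l, e') \<in> edges \<G>) \<longleftrightarrow>
        (\<exists>e'. (- k - 1, e') \<in> edges \<G> \<and> e = f ` e')"
    proof
      assume "\<exists>l e'. k = - (l + 1) \<and> e = identify A B C ` e' \<and> (l, e') \<in> edges \<G>"
      then obtain l e' where le: "k = - (l + 1)" "e = identify A B C ` e'" "(l, e') \<in> edges \<G>" by blast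
      then have "(- k - 1, e') \<in> edges \<G>" by simp
      moreover have "e = f ` e'" using iden[OF labelled_multigraph_edge(2)[OF mG le(3)]] le(2) by simp
      ultimately show "\<exists>e'. (- k - 1, e') \<in> edges \<G> \<and> e = f ` e'" by blast
    next
      assume "\<exists>e'. (- k - 1, e') \<in> edges \<G> \<and> e = f ` e'"
      then obtain e' where e': "(- k - 1, e') \<in> edges \<G>" "e = f ` e'" by blast
      then show "\<exists>l e'. k = - (l + 1) \<and> e = identify A B C ` e' \<and> (l, e') \<in> edges \<G>"
        using iden[OF labelled_multigraph_edge(2)[OF mG e'(1)]]
        by (intro exI[of _ "- k - 1"] exI[of _ e']) simp
    qed
    moreover have "(\<exists>e'. e = identify A B C ` e' \<and> (k, e') \<in> edges \<G>') \<longleftrightarrow>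
        (\<exists>e'. (k, e') \<in> edges \<G>' \<and> e = f' ` e')"
      using iden' labelled_multigraph_edge(2)[OF mG'] by metis
    ultimately show ?thesis by (simp add: glue_def)
  qed
  \<comment> \<open>The sign of a label determines its side: a label \<open>l\<close> of
    \<open>\<G>\<close> is nonnegative and becomes the negative \<open>k = -(l + 1)\<close>, so that
    \<open>l = - k - 1\<close>.\<close>
  have edges_neg: "(k, e) \<in> edges ?H \<longleftrightarrow> (\<exists>e'. (- k - 1, e') \<in> edges \<G> \<and> e = f ` e')" if "k < 0" for k e
    using edges[of k e] labelled_multigraph_edge(1)[OF mG', of k] that by auto
  have edges_nonneg: "(k, e) \<in> edges ?H \<longleftrightarrow> (\<exists>e'. (k, e') \<in> edges \<G>' \<and> e = f' ` e')" if "k \<ge> 0" for k e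
    using edges[of k e] labelled_multigraph_edge(1)[OF mG, of "- k - 1"] that by auto
  have unique: "e1 = e2"
    if "labelled_multigraph L \<Gamma>" "(l, e1) \<in> edges \<Gamma>" "(l, e2) \<in> edges \<Gamma>" "x \<in> e1" "x \<in> e2"
    for L and \<Gamma> :: "'v edge_labelled_graph" and l e1 e2 x
    using label_class(3)[OF that(1), of l] that(2-) unfolding disjoint_def by blast
  have ex: "\<exists>e. (l, e) \<in> edges \<Gamma>" if "labelled_multigraph L \<Gamma>" "l \<in> L"
    for L and \<Gamma> :: "'v edge_labelled_graph" and l
    using that by (simp add: labelled_multigraph_def)

  \<comment> \<open>The glued graph as a labelled multigraph\<close>
  have mH: "labelled_multigraph ?L ?H"
    unfolding labelled_multigraph_def
  proof (intro conjI ballI allI impI)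
    have "finite (verts \<G>)" "finite (verts \<G>')"
      using mG mG' by (simp_all add: labelled_multigraph_def)
    then show "finite (verts ?H)" by (simp add: verts V_def W_def)
    show "\<exists>m n. ?L = {m..n}" by (intro exI) (rule refl)
    show "edges ?H \<subseteq> ?L \<times> {e. e \<subseteq> verts ?H \<and> card e = 2}"
    proof (rule subrelI)
      fix k e assume ke: "(k, e) \<in> edges ?H"
      show "(k, e) \<in> ?L \<times> {e. e \<subseteq> verts ?H \<and> card e = 2}"
      proof (cases "k < 0")
        case True
        then obtain e' where e': "(- k - 1, e') \<in> edges \<G>" "e = f ` e'"
          using ke edges_neg[OF True] by blast
        have "card e = card e'" unfolding e'(2) by (rule card_image[OF inj_on_subset[OF injf(1) subset_UNIV]])
        with labelled_multigraph_edge[OF mG e'(1)] e'(2) True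
        show ?thesis by (simp add: verts V_def image_mono le_supI1)
      next
        case False
        then have k: "k \<ge> 0" by simp
        obtain e' where e': "(k, e') \<in> edges \<G>'" "e = f' ` e'"
          using ke edges_nonneg[OF k] by blast
        have "card e = card e'" unfolding e'(2) by (rule card_image[OF inj_on_subset[OF injf(2) subset_UNIV]])
        with labelled_multigraph_edge[OF mG' e'(1)] e'(2) k
        show ?thesis by (simp add: verts W_def image_mono le_supI2)
      qed
    qed
    show "e = e'" if *: "(k, e) \<in> edges ?H \<and> (k, e') \<in> edges ?H \<and> v \<in> e \<and> v \<in> e'" for v k e e'
    proof (cases "k < 0")
      case True
      obtain d where d: "(- k - 1, d) \<in> edges \<G>" "e = f ` d"
        using * edges_neg[OF True, of e] by blast
      obtain d' where d': "(- k - 1, d') \<in> edges \<G>" "e' = f ` d'"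
        using * edges_neg[OF True, of e'] by blast
      obtain x where x: "x \<in> d" "v = f x" using * d(2) by blast
      then have "x \<in> d'" using * d'(2) inj_image_mem_iff[OF injf(1)] by simp
      then show ?thesis using unique[OF mG d(1) d'(1) x(1)] d(2) d'(2) by simp
    next
      case False
      then have k: "k \<ge> 0" by simp
      obtain d where d: "(k, d) \<in> edges \<G>'" "e = f' ` d"
        using * edges_nonneg[OF k, of e] by blast
      obtain d' where d': "(k, d') \<in> edges \<G>'" "e' = f' ` d'"
        using * edges_nonneg[OF k, of e'] by blast
      obtain x where x: "x \<in> d" "v = f' x" using * d(2) by blast
      then have "x \<in> d'" using * d'(2) inj_image_mem_iff[OF injf(2)] by simp
      then show ?thesis using unique[OF mG' d(1) d'(1) x(1)] d(2) d'(2) by simp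
    qed
    show "\<exists>e. (k, e) \<in> edges ?H" if "k \<in> ?L" for k
    proof (cases "k < 0")
      case True
      then have "\<exists>e. (- k - 1, e) \<in> edges \<G>" using that by (intro ex[OF mG]) auto
      then show ?thesis using edges_neg[OF True] by blast
    next
      case False
      then have "\<exists>e. (k, e) \<in> edges \<G>'" using that by (intro ex[OF mG']) auto
      then show ?thesis using edges_nonneg[of k] False by auto
    qed
  qed

  \<comment> \<open>The generators of the glued graph as conjugates\<close>
  have \<sigma>_neg: "?\<sigma> k = f \<circ> ?\<rho> (- k - 1) \<circ> f" if "k < 0" for k
    using edges_neg[OF that] by (rule label_involution_relabel[OF mG mH ff(1)])
  have \<sigma>_nonneg: "?\<sigma> k = f' \<circ> ?\<rho>' k \<circ> f'" if "k \<ge> 0" for k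
    using edges_nonneg[OF that] by (rule label_involution_relabel[OF mG' mH ff(2)])
  note pG = pendant_zero_vertex_pendant_set[OF mG assms(4)]
  note pG' = pendant_zero_vertex_pendant_set[OF mG' assms(6)]
  have pendV: "pendant_set C V (?\<sigma> ` {..<0})"
    by (rule pendant_set_subset[OF pendant_set_conj[OF ff(1) pG(2), unfolded fC, folded V_def]])
      (use \<sigma>_neg in auto)
  have pendW: "pendant_set C W (?\<sigma> ` {0..})"
    by (rule pendant_set_subset[OF pendant_set_conj[OF ff(2) pG'(2), unfolded fC, folded W_def]])
      (use \<sigma>_nonneg in auto)
  \<comment> \<open>Only the label 0 of either graph moves the vertex to be glued, and these two
    labels become \<open>- 1\<close> and \<open>0\<close>.\<close>
  have fixC: "?\<sigma> k C = C" if "k < - 1 \<or> k > 0" for k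
  proof (cases "k < 0")
    case True
    then have "?\<rho> (- k - 1) A = A" using that by (intro pG(1)) auto
    then show ?thesis using \<sigma>_neg[OF True] by (simp add: f_def)
  next
    case False
    then have "?\<rho>' k B = B" using that by (intro pG'(1)) auto
    then show ?thesis using \<sigma>_nonneg[of k] False by (simp add: f'_def)
  qed

  \<comment> \<open>Commutation of distant labels\<close>
  have commute_mixed: "?\<sigma> i \<circ> ?\<sigma> j = ?\<sigma> j \<circ> ?\<sigma> i" if "i < 0" "j \<ge> 0" "\<bar>i - j\<bar> \<ge> 2" for i j
  proof (rule permutes_commute_common_fixpoint[OF _ _ VW])
    show "?\<sigma> i permutes V" using pendV that by (simp add: pendant_set_def)
    show "?\<sigma> j permutes W" using pendW that by (simp add: pendant_set_def)
    \<comment> \<open>Distance at least 2 excludes the pair \<open>- 1\<close> and \<open>0\<close>,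
      so one of the two generators fixes the only vertex shared by both sides.\<close>
    have "i < - 1 \<or> j > 0" using that by linarith
    then show "?\<sigma> i C = C \<or> ?\<sigma> j C = C" using fixC by blast
  qed
  have conj_comp: "(g \<circ> p \<circ> g) \<circ> (g \<circ> q \<circ> g) = g \<circ> (p \<circ> q) \<circ> g" if "g \<circ> g = id" for g p q :: "'v \<Rightarrow> 'v"
    using that by (metis comp_assoc id_comp)
  have commute: "?\<sigma> i \<circ> ?\<sigma> j = ?\<sigma> j \<circ> ?\<sigma> i" if "i \<in> ?L" "j \<in> ?L" "\<bar>i - j\<bar> \<ge> 2" for i j
  proof -
    consider "i < 0" "j < 0" | "i \<ge> 0" "j \<ge> 0" | "i < 0" "j \<ge> 0" | "i \<ge> 0" "j < 0" by linarith
    then show ?thesis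
    proof cases
      case 1
      \<comment> \<open>The order of the labels is reversed on this side, but their distances are
        kept.\<close>
      then have "?\<rho> (- i - 1) \<circ> ?\<rho> (- j - 1) = ?\<rho> (- j - 1) \<circ> ?\<rho> (- i - 1)"
        using that by (intro G[THEN conjunct2, THEN conjunct1, rule_format]) auto
      with 1 show ?thesis by (simp only: \<sigma>_neg conj_comp[OF ff(1)])
    next
      case 2
      then have "?\<rho>' i \<circ> ?\<rho>' j = ?\<rho>' j \<circ> ?\<rho>' i"
        using that by (intro G'[THEN conjunct2, THEN conjunct1, rule_format]) auto
      with 2 show ?thesis by (simp only: \<sigma>_nonneg conj_comp[OF ff(2)])
    next
      case 3
      then show ?thesis using commute_mixed that(3) by blast
    next
      case 4
      then show ?thesis using commute_mixed[of j i] that(3) by (simp add: abs_minus_commute)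
    qed
  qed

  \<comment> \<open>The intersection property\<close>
  have Int_neg: "perm_span (?\<sigma> ` I) \<inter> perm_span (?\<sigma> ` J) = perm_span (?\<sigma> ` (I \<inter> J))"
    if "I \<subseteq> ?L \<inter> {..<0}" "J \<subseteq> ?L \<inter> {..<0}" for I J
  proof (rule perm_span_Int_relabel[OF ff(1), of "?L \<inter> {..<0}" ?\<sigma> ?\<rho> "\<lambda>k. - k - 1" ?L1])
    show "perm_span (?\<rho> ` I) \<inter> perm_span (?\<rho> ` J) = perm_span (?\<rho> ` (I \<inter> J))"
      if "I \<subseteq> ?L1" "J \<subseteq> ?L1" for I J using G that by blast
  qed (use that \<sigma>_neg in \<open>auto simp: inj_on_def\<close>)
  have Int_nonneg: "perm_span (?\<sigma> ` I) \<inter> perm_span (?\<sigma> ` J) = perm_span (?\<sigma> ` (I \<inter> J))"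
    if "I \<subseteq> ?L \<inter> {0..}" "J \<subseteq> ?L \<inter> {0..}" for I J
  proof (rule perm_span_Int_relabel[OF ff(2), of "?L \<inter> {0..}" ?\<sigma> ?\<rho>' "\<lambda>k. k" ?L2])
    show "perm_span (?\<rho>' ` I) \<inter> perm_span (?\<rho>' ` J) = perm_span (?\<rho>' ` (I \<inter> J))"
      if "I \<subseteq> ?L2" "J \<subseteq> ?L2" for I J using G' that by blast
  qed (use that \<sigma>_nonneg in \<open>auto simp: inj_on_def\<close>)
  have "finite V" "finite W"
    using mG mG' by (simp_all add: V_def W_def labelled_multigraph_def)
  have "perm_span (?\<sigma> ` I) \<inter> perm_span (?\<sigma> ` J) = perm_span (?\<sigma> ` (I \<inter> J))"
    if "I \<subseteq> ?L" "J \<subseteq> ?L" for I J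
  proof -
    \<comment> \<open>Labels are separated by sign; each half of a label set acts on its own side,
      which is the form that \<open>perm_span_Un_Int\<close> requires.\<close>
    have split: "?\<sigma> ` M = ?\<sigma> ` (M \<inter> {..<0}) \<union> ?\<sigma> ` (M \<inter> {0..})" for M
      unfolding image_Un[symmetric] by (intro arg_cong[of _ _ "image ?\<sigma>"]) auto
    have V: "pendant_set C V (?\<sigma> ` (M \<inter> {..<0}))" for M
      by (rule pendant_set_subset[OF pendV]) blast
    have W: "pendant_set C W (?\<sigma> ` (M \<inter> {0..}))" for M
      by (rule pendant_set_subset[OF pendW]) blast
    have *: "(I \<inter> M) \<inter> (J \<inter> M) = (I \<inter> J) \<inter> M" for M by blast
    show ?thesis
      unfolding split[of I] split[of J] split[of "I \<inter> J"]
    proof (rule perm_span_Un_Int[OF \<open>finite V\<close> \<open>finite W\<close> VW V V V W W W])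
      show "perm_span (?\<sigma> ` (I \<inter> {..<0})) \<inter> perm_span (?\<sigma> ` (J \<inter> {..<0})) = perm_span (?\<sigma> ` (I \<inter> J \<inter> {..<0}))"
        using Int_neg[of "I \<inter> {..<0}" "J \<inter> {..<0}"] that unfolding * by blast
      show "perm_span (?\<sigma> ` (I \<inter> {0..})) \<inter> perm_span (?\<sigma> ` (J \<inter> {0..})) = perm_span (?\<sigma> ` (I \<inter> J \<inter> {0..}))"
        using Int_nonneg[of "I \<inter> {0..}" "J \<inter> {0..}"] that unfolding * by blast
    qed
  qed
  then show ?thesis unfolding CPR_graph_iff using mH commute by blast
qed

end
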